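(* For integers $m\ge1$, $n\ge0$, $k\ge0$, $$S(m,n,k)=h_{n-k}(1,m+1,2m+1,\dots,km+1)$$ and $$\overline S(m,n,k)=h_{n-k}(1,m+1,2m+1,\dots,km+1)-n\,h_{n-k-1}(m,2m,\dots,km).$$
   Context: $h_j(y_1,\dots,y_r)$ is the complete homogeneous symmetric polynomial of degree $j$ (the sum of all monomials of degree $j$), with $h_0=1$ and $h_j=0$ for $j<0$ (and $h_j$ of no variables equal to $\delta_{j,0}$). Let $\zeta_m=e^{2\pi i/m}$, $\mathbf e_1,\dots,\mathbf e_n$ the standard basis of $\mathbb C^n$, $i^c=\zeta_m^c\mathbf e_i$ for $i\in[n]$ (colors mod $m$), and $[n^m]=\{0\}\cup\{i^c:i\in[n],0\le c<m\}$. For a scalar $z$ and $S\subseteq[n^m]$, $zS=\{zs:s\in S\}$. A colored set partition of type $(m,n)$ is a set partition of $[n^m]$ into blocks $S_0,S_1,\dots,S_{km}$ such that (i) $0\in S_0$, and if $i^c\in S_0$ for some $c$ then $i^d\in S_0$ for all $d$; (ii) for each $0\le l<k$ the blocks $S_{lm+1},\dots,S_{(l+1)m}$ are distinct and equal to $S,\zeta_mS,\dots,\zeta_m^{m-1}S$ for some $S$. $S(m,n,k)$ is the number of such partitions with $km+1$ blocks; $\overline S(m,n,k)$ is the number of those whose zero block $S_0$ is not of the form $\{0,i^0,i^1,\dots,i^{m-1}\}$ for any $i\in[n]$. *)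

theory Defs
  imports Complex_Main "HOL-Library.Disjoint_Sets" "Jordan_Normal_Form.Matrix"
begin

text \<open>
  The variables are given as a list. The monomials of degree \<open>j\<close> are enumerated by their lists of
  exponents.
\<close>

definition complete_homogeneous :: "int \<Rightarrow> 'a::comm_semiring_1 list \<Rightarrow> 'a" where
  "complete_homogeneous j ys =
     (if j < 0 then 0
      else \<Sum>as | length as = length ys \<and> sum_list as = nat j. \<Prod>i<length ys. ys ! i ^ as ! i)"

definition zeta :: "nat \<Rightarrow> complex" where
  "zeta m = exp (2 * of_real pi * \<i> / of_nat m)"

text \<open>
  \<open>\<complex>\<^sup>n\<close> is \<open>carrier_vec n\<close>, whose coordinates are numbered from 0, so the index set
  \<open>[n]\<close> is \<open>{..<n}\<close>; \<open>colored_elem m n i c\<close> is \<open>i\<^sup>c\<close>.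
\<close>

definition colored_elem :: "nat \<Rightarrow> nat \<Rightarrow> nat \<Rightarrow> nat \<Rightarrow> complex vec" where
  "colored_elem m n i c = zeta m ^ c \<cdot>\<^sub>v unit_vec n i"

definition colored_ground :: "nat \<Rightarrow> nat \<Rightarrow> complex vec set" where
  "colored_ground m n = insert (0\<^sub>v n) {colored_elem m n i c | i c. i < n \<and> c < m}"

definition scale_set :: "complex \<Rightarrow> complex vec set \<Rightarrow> complex vec set" where
  "scale_set z S = (\<lambda>s. z \<cdot>\<^sub>v s) ` S"

text \<open>
  A partition is an unordered set of blocks; the numbering \<open>B\<close> of its blocks is only required to
  exist. Distinctness of the blocks within each group of \<open>m\<close> is part of \<open>bij_betw\<close>.
\<close>

definition colored_set_partition :: "nat \<Rightarrow> nat \<Rightarrow> complex vec set set \<Rightarrow> bool" where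
  "colored_set_partition m n P \<longleftrightarrow>
     partition_on (colored_ground m n) P \<and>
     (\<exists>k B. bij_betw B {0..k * m} P \<and>
        0\<^sub>v n \<in> B 0 \<and>
        (\<forall>i<n. (\<exists>c<m. colored_elem m n i c \<in> B 0) \<longrightarrow> (\<forall>d<m. colored_elem m n i d \<in> B 0)) \<and>
        (\<forall>l<k. \<exists>S. \<forall>j<m. B (l * m + 1 + j) = scale_set (zeta m ^ j) S))"

definition zero_block :: "nat \<Rightarrow> complex vec set set \<Rightarrow> complex vec set" where
  "zero_block n P = (THE S. S \<in> P \<and> 0\<^sub>v n \<in> S)"

definition colored_stirling :: "nat \<Rightarrow> nat \<Rightarrow> nat \<Rightarrow> nat" where
  "colored_stirling m n k = card {P. colored_set_partition m n P \<and> card P = k * m + 1}"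

definition colored_stirling_bar :: "nat \<Rightarrow> nat \<Rightarrow> nat \<Rightarrow> nat" where
  "colored_stirling_bar m n k =
     card {P. colored_set_partition m n P \<and> card P = k * m + 1 \<and>
              \<not> (\<exists>i<n. zero_block n P = insert (0\<^sub>v n) (colored_elem m n i ` {..<m}))}"

end

theory Submission
  imports Defs
begin

text \<open>
  Partitions are encoded by maps on the index set, and the maps are counted by induction on the
  largest index \<open>x\<close>. It lies in the zero block, or starts a new group of \<open>m\<close> blocks, or joins one of
  the \<open>k m\<close> existing nonzero blocks. This is the recurrence
  \<open>h\<^sub>j(y\<^sub>0, \<dots>, y\<^sub>k) = h\<^sub>j(y\<^sub>0, \<dots>, y\<^sub>k\<^sub>-\<^sub>1) + y\<^sub>k h\<^sub>j\<^sub>-\<^sub>1(y\<^sub>0, \<dots>, y\<^sub>k)\<close>. If the zero block must be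
  \<open>{0}\<close>, the first option disappears and \<open>k m + 1\<close> becomes \<open>k m\<close>. A partition with zero block
  \<open>{0, i\<^sup>0, \<dots>, i\<^sup>m\<^sup>-\<^sup>1}\<close> is one of the latter kind on the indices other than \<open>i\<close>.
\<close>

section \<open>Complete homogeneous polynomials\<close>

lemma finite_lists_sum_eq: "finite {as::nat list. length as = l \<and> sum_list as = N}"
proof (rule finite_subset)
  show "{as::nat list. length as = l \<and> sum_list as = N} \<subseteq> {as. set as \<subseteq> {..N} \<and> length as = l}"
    using member_le_sum_list by fastforce
  show "finite {as. set as \<subseteq> {..N} \<and> length as = l}"
    by (rule finite_lists_length_eq) simp
qed

lemma complete_homogeneous_neg: "j < 0 \<Longrightarrow> complete_homogeneous j ys = 0"
  by (simp add: complete_homogeneous_def)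

lemma complete_homogeneous_nat:
  "complete_homogeneous (int N) ys =
     (\<Sum>as | length as = length ys \<and> sum_list as = N. \<Prod>i<length ys. ys ! i ^ as ! i)"
  by (simp add: complete_homogeneous_def)

lemma complete_homogeneous_0: "complete_homogeneous 0 ys = 1"
proof -
  have "{as::nat list. length as = length ys \<and> sum_list as = 0} = {replicate (length ys) 0}"
    by (auto simp: sum_list_eq_0_iff intro: replicate_eqI)
  then show ?thesis
    by (simp add: complete_homogeneous_def)
qed

lemma complete_homogeneous_Nil: "complete_homogeneous j [] = of_bool (j = 0)"
proof -
  have "{as::nat list. as = [] \<and> sum_list as = nat j} = (if nat j = 0 then {[]} else {})"
    by auto
  then show ?thesis
    by (auto simp: complete_homogeneous_def)
qed

text \<open>Exponent lists are split by the exponent of \<open>y\<close>: if it is zero, a monomial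
  in \<open>ys\<close> remains; if it is positive, one factor \<open>y\<close> can be taken out.
  Degrees at most 0 are treated apart: at \<open>j = 0\<close> the second summand vanishes because
  its degree is -1.\<close>

lemma complete_homogeneous_snoc:
  "complete_homogeneous j (ys @ [y]) =
     complete_homogeneous j ys + y * complete_homogeneous (j - 1) (ys @ [y])"
proof (cases "j \<le> 0")
  case True
  then show ?thesis
    by (cases "j = 0") (simp_all add: complete_homogeneous_neg complete_homogeneous_0)
next
  case False
  then obtain N where j: "j = int (Suc N)"
    by (metis not_le zero_less_imp_eq_int Suc_pred)
  let ?l = "length ys"
  let ?L = "\<lambda>l N. {as::nat list. length as = l \<and> sum_list as = N}"
  let ?t = "\<lambda>as. \<Prod>i<Suc ?l. (ys @ [y]) ! i ^ as ! i"
  let ?A = "(\<lambda>bs. bs @ [0]) ` ?L ?l (Suc N)"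
  \<comment> \<open>Raising the last exponent puts the exponent lists of sum \<open>N\<close> in
    bijection with those of sum \<open>Suc N\<close> whose last exponent is positive.\<close>
  let ?up = "\<lambda>as::nat list. butlast as @ [Suc (last as)]"
  let ?B = "?up ` ?L (Suc ?l) N"
  have split: "?L (Suc ?l) (Suc N) = ?A \<union> ?B"
  proof (intro equalityI subsetI)
    fix as assume as: "as \<in> ?L (Suc ?l) (Suc N)"
    then obtain bs b where bs: "as = bs @ [b]" "length bs = ?l"
      by (metis (mono_tags, lifting) length_Suc_conv_rev mem_Collect_eq)
    show "as \<in> ?A \<union> ?B"
    proof (cases b)
      case 0
      then show ?thesis using as bs by auto
    next
      case (Suc b')
      then have "as = ?up (bs @ [b'])" "bs @ [b'] \<in> ?L (Suc ?l) N"
        using as bs by auto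
      then show ?thesis by blast
    qed
  next
    fix as assume "as \<in> ?A \<union> ?B"
    moreover have "?up cs \<in> ?L (Suc ?l) (Suc N)" if "cs \<in> ?L (Suc ?l) N" for cs
      using that by (cases cs rule: rev_cases) auto
    ultimately show "as \<in> ?L (Suc ?l) (Suc N)" by auto
  qed
  have disj: "?A \<inter> ?B = {}" by auto
  have inj: "inj_on ?up (?L (Suc ?l) N)"
  proof (rule inj_onI)
    fix as bs assume "as \<in> ?L (Suc ?l) N" "bs \<in> ?L (Suc ?l) N" "?up as = ?up bs"
    then show "as = bs"
      by (cases as rule: rev_cases; cases bs rule: rev_cases) auto
  qed
  have up: "?t (?up as) = y * ?t as" if as: "as \<in> ?L (Suc ?l) N" for as
  proof -
    obtain bs b where bs: "as = bs @ [b]" "length bs = ?l"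
      using as by (metis (mono_tags, lifting) length_Suc_conv_rev mem_Collect_eq)
    have "(\<Prod>i<?l. (ys @ [y]) ! i ^ (bs @ [c]) ! i) = (\<Prod>i<?l. ys ! i ^ bs ! i)" for c
      by (rule prod.cong) (auto simp: nth_append bs)
    with bs show ?thesis by (simp add: nth_append mult_ac)
  qed
  have zero: "?t (bs @ [0]) = (\<Prod>i<?l. ys ! i ^ bs ! i)" if "bs \<in> ?L ?l (Suc N)" for bs
  proof -
    have "(\<Prod>i<?l. (ys @ [y]) ! i ^ (bs @ [0]) ! i) = (\<Prod>i<?l. ys ! i ^ bs ! i)"
      by (rule prod.cong) (use that in \<open>auto simp: nth_append\<close>)
    then show ?thesis using that by (simp add: nth_append)
  qed
  have "sum ?t (?L (Suc ?l) (Suc N)) = sum ?t ?A + sum ?t ?B"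
    unfolding split by (rule sum.union_disjoint) (use disj finite_lists_sum_eq in auto)
  also have "sum ?t ?A = (\<Sum>bs\<in>?L ?l (Suc N). ?t (bs @ [0]))"
    by (subst sum.reindex) (auto simp: inj_on_def)
  also have "\<dots> = (\<Sum>bs\<in>?L ?l (Suc N). \<Prod>i<?l. ys ! i ^ bs ! i)"
    by (rule sum.cong[OF refl zero])
  also have "sum ?t ?B = (\<Sum>as\<in>?L (Suc ?l) N. ?t (?up as))"
    by (subst sum.reindex[OF inj]) (simp add: o_def)
  also have "\<dots> = (\<Sum>as\<in>?L (Suc ?l) N. y * ?t as)"
    by (rule sum.cong[OF refl up])
  finally show ?thesis
    using j complete_homogeneous_nat[of "Suc N" "ys @ [y]"] complete_homogeneous_nat[of N "ys @ [y]"]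
      complete_homogeneous_nat[of "Suc N" ys]
    by (simp add: sum_distrib_left)
qed

text \<open>The recurrence keeps the long list when it lowers the degree, so the induction on the
  list contains one on the degree. This will turn the variables \<open>0, m, ..., k m\<close> of the
  full codes into \<open>m, ..., k m\<close>.\<close>

lemma complete_homogeneous_zero_var: "complete_homogeneous j (0 # ys) = complete_homogeneous j ys"
proof (induction ys arbitrary: j rule: rev_induct)
  case Nil
  then show ?case using complete_homogeneous_snoc[of j "[]" 0] by simp
next
  case (snoc y ys)
  show ?case
  proof (cases "j < 0")
    case True
    then show ?thesis by (simp add: complete_homogeneous_neg)
  next
    case False
    then have "0 \<le> j" by simp
    then show ?thesis
    proof (induction j rule: int_ge_induct)
      case base
      show ?case by (simp add: complete_homogeneous_0)
    next
      case (step i)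
      then show ?case
        using complete_homogeneous_snoc[of "i + 1" "0 # ys" y]
          complete_homogeneous_snoc[of "i + 1" ys y] snoc by simp
    qed
  qed
qed

section \<open>Codes\<close>

text \<open>
  A colored partition is encoded by the map sending \<open>i\<close> to \<open>None\<close> if \<open>i\<^sup>0\<close> lies in the zero block,
  and otherwise to \<open>(j, b)\<close>, where \<open>j\<close> is the least index occurring in the block of \<open>i\<^sup>0\<close> and
  \<open>j\<^sup>b\<close> is its element of index \<open>j\<close>.
\<close>

definition code :: "nat \<Rightarrow> (nat \<rightharpoonup> nat \<times> nat) \<Rightarrow> bool" where
  "code m r \<longleftrightarrow> (\<forall>i j b. r i = Some (j, b) \<longrightarrow> j \<le> i \<and> b < m \<and> r j = Some (j, 0))"

text \<open>A root is the least index occurring in its group of \<open>m\<close> rotated blocks, so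
  there is one root for each group.\<close>

definition roots :: "(nat \<rightharpoonup> nat \<times> nat) \<Rightarrow> nat set" where
  "roots r = {j. r j = Some (j, 0)}"

lemma codeD:
  assumes "code m r" "r i = Some (j, b)"
  shows "j \<le> i" "b < m" "r j = Some (j, 0)"
  using assms unfolding code_def by blast+

lemma roots_subset_dom: "roots r \<subseteq> dom r"
  by (auto simp: roots_def)

text \<open>The flag \<open>full\<close> forces the zero block to be trivial over \<open>J\<close>.
  The index set \<open>J\<close> is arbitrary because the second formula deletes one index from
  \<open>{..<n}\<close>.\<close>

definition codes :: "bool \<Rightarrow> nat \<Rightarrow> nat set \<Rightarrow> nat \<Rightarrow> (nat \<rightharpoonup> nat \<times> nat) set" where
  "codes full m J k =
     {r. code m r \<and> dom r \<subseteq> J \<and> (full \<longrightarrow> dom r = J) \<and> card (roots r) = k}"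

lemma finite_codes:
  assumes "finite J"
  shows "finite (codes full m J k)"
proof (rule finite_subset)
  show "codes full m J k \<subseteq> (\<Union>D\<in>Pow J. {r. dom r = D \<and> ran r \<subseteq> J \<times> {..<m}})"
  proof
    fix r assume r: "r \<in> codes full m J k"
    have "ran r \<subseteq> J \<times> {..<m}"
    proof
      fix p assume "p \<in> ran r"
      then obtain i where "r i = Some (fst p, snd p)" by (auto simp: ran_def)
      moreover from this have "snd p < m" "r (fst p) = Some (fst p, 0)"
        using r codeD[of m r i] unfolding codes_def by blast+
      ultimately show "p \<in> J \<times> {..<m}"
        using r by (cases p) (auto simp: codes_def)
    qed
    then show "r \<in> (\<Union>D\<in>Pow J. {r. dom r = D \<and> ran r \<subseteq> J \<times> {..<m}})"
      using r by (auto simp: codes_def)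
  qed
  show "finite (\<Union>D\<in>Pow J. {r. dom r = D \<and> ran r \<subseteq> J \<times> {..<m}})"
    using assms by (auto intro!: finite_set_of_finite_maps intro: finite_subset)
qed

section \<open>The recurrence for the number of codes\<close>

definition old_values :: "bool \<Rightarrow> nat \<Rightarrow> (nat \<rightharpoonup> nat \<times> nat) \<Rightarrow> (nat \<times> nat) option set" where
  "old_values full m r = (if full then {} else {None}) \<union> Some ` (roots r \<times> {..<m})"

text \<open>The values open to a new largest index that does not become a root are the zero block
  and \<open>m\<close> colors over each root. Their number depends on \<open>r\<close> only through
  the number of its roots.\<close>

lemma card_old_values:
  assumes "finite (roots r)"
  shows "card (old_values full m r) = card (roots r) * m + of_bool (\<not> full)"
proof -
  have "card (Some ` (roots r \<times> {..<m})) = card (roots r) * m"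
    by (simp add: card_image card_cartesian_product)
  moreover have "card (old_values full m r) =
      card (if full then {} else {None :: (nat \<times> nat) option}) + card (Some ` (roots r \<times> {..<m}))"
    unfolding old_values_def using assms by (intro card_Un_disjoint) auto
  ultimately show ?thesis by simp
qed

lemma roots_upd:
  assumes "r x = None" "v \<noteq> Some (x, 0)"
  shows "roots (r(x := v)) = roots r"
  using assms by (auto simp: roots_def)

lemma roots_upd_new: "roots (r(x \<mapsto> (x, 0))) = insert x (roots r)"
  by (auto simp: roots_def)

lemma code_upd_old:
  assumes "code m r" "\<forall>i\<in>dom r. i < x" "v \<in> old_values full m r"
  shows "code m (r(x := v))"
  unfolding code_def
proof (intro allI impI)
  fix i j b assume *: "(r(x := v)) i = Some (j, b)"
  have root: "j < x" if "r j = Some (j, 0)" for j using assms(2) that by auto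
  show "j \<le> i \<and> b < m \<and> (r(x := v)) j = Some (j, 0)"
  proof (cases "i = x")
    case True
    then have "r j = Some (j, 0)" "b < m"
      using * assms(3) by (auto simp: old_values_def roots_def split: if_splits)
    then show ?thesis using root[of j] True by auto
  next
    case False
    then have "r i = Some (j, b)" using * by simp
    from codeD[OF assms(1) this] root[of j] show ?thesis by auto
  qed
qed

lemma code_upd_new:
  assumes "code m r" "\<forall>i\<in>dom r. i < x" "0 < m"
  shows "code m (r(x \<mapsto> (x, 0)))"
  using assms unfolding code_def by (auto split: if_splits)

text \<open>No other index points to the largest index \<open>x\<close>, because pointers never go
  upwards. Erasing its value therefore leaves no dangling pointer.\<close>

lemma code_remove:
  assumes "code m r" "\<forall>i\<in>dom r. i \<le> x"
  shows "code m (r(x := None))"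
  unfolding code_def
proof (intro allI impI)
  fix i j b assume *: "(r(x := None)) i = Some (j, b)"
  then have "i \<noteq> x" and r: "r i = Some (j, b)" by (auto split: if_splits)
  moreover have "i \<le> x" using r assms(2) by auto
  ultimately show "j \<le> i \<and> b < m \<and> (r(x := None)) j = Some (j, 0)"
    using codeD[OF assms(1) r] by auto
qed

text \<open>Erasing the value at the largest index \<open>x\<close> gives a code on
  \<open>J\<close>. The number of roots drops exactly when that value was \<open>(x, 0)\<close>,
  which separates the two families. The guard \<open>k = 0\<close> is there because
  \<open>k - 1\<close> is truncated.\<close>

lemma codes_insert:
  assumes "0 < m" "finite J" "\<forall>i\<in>J. i < x"
  shows "codes full m (insert x J) k =
           (\<lambda>(r, v). r(x := v)) ` Sigma (codes full m J k) (old_values full m) \<union>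
           (\<lambda>r. r(x \<mapsto> (x, 0))) ` (if k = 0 then {} else codes full m J (k - 1))"
    (is "?L = ?O \<union> ?N")
proof (intro equalityI subsetI)
  have x: "x \<notin> J" using assms(3) by auto
  fix r assume r: "r \<in> ?L"
  let ?r = "r(x := None)"
  have code: "code m r" and dom: "dom r \<subseteq> insert x J" and k: "card (roots r) = k"
    and full: "full \<Longrightarrow> dom r = insert x J"
    using r by (auto simp: codes_def)
  have fin: "finite (roots r)"
    using roots_subset_dom dom assms(2) by (meson finite_insert finite_subset)
  have "\<forall>i\<in>dom r. i \<le> x" using dom assms(3) by fastforce
  then have code': "code m ?r" by (rule code_remove[OF code])
  have dom': "dom ?r \<subseteq> J" "full \<Longrightarrow> dom ?r = J"
    using dom full x by auto
  show "r \<in> ?O \<union> ?N"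
  proof (cases "r x = Some (x, 0)")
    case True
    have eq: "roots r = insert x (roots ?r)"
      using True roots_upd_new[of ?r x] by (metis fun_upd_triv fun_upd_upd)
    have "x \<notin> roots ?r" by (auto simp: roots_def)
    with eq fin k have "k \<noteq> 0" "card (roots ?r) = k - 1" by auto
    then have "?r \<in> (if k = 0 then {} else codes full m J (k - 1))"
      using code' dom' by (auto simp: codes_def)
    moreover have "r = ?r(x \<mapsto> (x, 0))" using True by auto
    ultimately show ?thesis by blast
  next
    case False
    have "roots ?r = roots r"
      using False by (auto simp: roots_def)
    with k have mem: "?r \<in> codes full m J k"
      using code' dom' by (auto simp: codes_def)
    have "r x \<in> old_values full m ?r"
    proof (cases "r x")
      case None
      then have "\<not> full" using full by auto
      then show ?thesis using None by (simp add: old_values_def)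
    next
      case (Some p)
      then obtain j b where p: "r x = Some (j, b)" by (cases p) auto
      from codeD[OF code p] False p have "b < m" "r j = Some (j, 0)" "j \<noteq> x" by auto
      then show ?thesis using p by (auto simp: old_values_def roots_def)
    qed
    with mem have "(?r, r x) \<in> Sigma (codes full m J k) (old_values full m)" by simp
    moreover have "r = (\<lambda>(r, v). r(x := v)) (?r, r x)" by auto
    ultimately show ?thesis by blast
  qed
next
  have x: "x \<notin> J" using assms(3) by auto
  fix r' assume "r' \<in> ?O \<union> ?N"
  then show "r' \<in> ?L"
  proof
    assume "r' \<in> ?O"
    then obtain r v where r: "r \<in> codes full m J k" and v: "v \<in> old_values full m r"
      and r': "r' = r(x := v)" by auto
    have dom: "dom r \<subseteq> J" using r by (simp add: codes_def)
    then have "r x = None" using x by auto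
    moreover from this have "v \<noteq> Some (x, 0)" using v
      by (auto simp: old_values_def roots_def split: if_splits)
    ultimately have "roots r' = roots r" using roots_upd r' by simp
    moreover have "code m r'"
      unfolding r' using r dom assms(3) v by (intro code_upd_old) (auto simp: codes_def)
    moreover have "dom r' \<subseteq> insert x J" using dom r' by (auto split: if_splits)
    moreover have "dom r' = insert x J" if full
    proof -
      have "v \<noteq> None" using v that by (auto simp: old_values_def)
      then show ?thesis using r that r' by (auto simp: codes_def)
    qed
    ultimately show ?thesis using r by (auto simp: codes_def)
  next
    assume "r' \<in> ?N"
    then obtain r where k: "k \<noteq> 0" and r: "r \<in> codes full m J (k - 1)"
      and r': "r' = r(x \<mapsto> (x, 0))" by (auto split: if_splits)
    have dom: "dom r \<subseteq> J" using r by (simp add: codes_def)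
    have "finite (roots r)" "x \<notin> roots r"
      using roots_subset_dom[of r] dom assms(2) x by (auto intro: finite_subset)
    then have "card (roots r') = k"
      using k r unfolding r' roots_upd_new by (simp add: codes_def)
    moreover have "code m r'"
      unfolding r' using r dom assms by (intro code_upd_new) (auto simp: codes_def)
    ultimately show ?thesis using r r' by (auto simp: codes_def)
  qed
qed

text \<open>All fibres over \<open>codes full m J k\<close> have the same size, \<open>k m\<close>
  plus one if the zero block is allowed. Both extension maps are injective because the value they
  overwrite at \<open>x\<close> is always \<open>None\<close>.\<close>

lemma card_codes_insert:
  assumes "0 < m" "finite J" "\<forall>i\<in>J. i < x"
  shows "card (codes full m (insert x J) k) =
           (k * m + of_bool (\<not> full)) * card (codes full m J k) +
           (if k = 0 then 0 else card (codes full m J (k - 1)))"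
proof -
  have dom: "dom r \<subseteq> J" if "r \<in> codes full m J k" for r k
    using that by (simp add: codes_def)
  have none: "r x = None" if "r \<in> codes full m J k" for r k
    using dom[OF that] assms(3) by auto
  have roots: "finite (roots r)" if "r \<in> codes full m J k" for r k
    using dom[OF that] roots_subset_dom assms(2) by (meson finite_subset)
  let ?f = "\<lambda>(r, v). r(x := v)" and ?g = "\<lambda>r. r(x \<mapsto> (x, 0))"
  let ?O = "Sigma (codes full m J k) (old_values full m)"
  let ?N = "if k = 0 then {} else codes full m J (k - 1)"
  have finO: "finite ?O"
    using assms(2) roots by (intro finite_SigmaI finite_codes) (auto simp: old_values_def)
  have injf: "inj_on ?f ?O"
  proof (rule inj_onI, clarify)
    fix r v r' v' assume *: "r \<in> codes full m J k" "r' \<in> codes full m J k"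
      and eq: "r(x := v) = r'(x := v')"
    have "v = v'" using fun_cong[OF eq, of x] by simp
    moreover have "r i = r' i" for i
      using fun_cong[OF eq, of i] none[OF *(1)] none[OF *(2)] by (cases "i = x") auto
    ultimately show "r = r' \<and> v = v'" by auto
  qed
  have injg: "inj_on ?g ?N"
  proof (rule inj_onI)
    fix r r' assume *: "r \<in> ?N" "r' \<in> ?N" and eq: "?g r = ?g r'"
    have "r i = r' i" for i
      using fun_cong[OF eq, of i] * none[of r "k - 1"] none[of r' "k - 1"]
      by (cases "i = x") (auto split: if_splits)
    then show "r = r'" by auto
  qed
  \<comment> \<open>A code on \<open>J\<close> does not have \<open>x\<close> as a root, so
    \<open>(x, 0)\<close> is never an old value; the value at \<open>x\<close> tells the two
    families apart.\<close>
  have disj: "?f ` ?O \<inter> ?g ` ?N = {}"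
  proof -
    have "v \<noteq> Some (x, 0)" if "r \<in> codes full m J k" "v \<in> old_values full m r" for r v
      using that none[OF that(1)] by (auto simp: old_values_def roots_def split: if_splits)
    moreover have "v = Some (x, 0)" if "r(x := v) = r'(x \<mapsto> (x, 0))" for r r' :: "nat \<rightharpoonup> nat \<times> nat" and v
      using fun_cong[OF that, of x] by simp
    ultimately show ?thesis by fastforce
  qed
  have "card (codes full m (insert x J) k) = card (?f ` ?O) + card (?g ` ?N)"
    unfolding codes_insert[OF assms]
    by (rule card_Un_disjoint) (use finO disj assms(2) finite_codes in auto)
  also have "card (?f ` ?O) = card ?O" by (rule card_image[OF injf])
  also have "\<dots> = (\<Sum>r\<in>codes full m J k. card (old_values full m r))"
    using assms(2) roots by (intro card_SigmaI finite_codes) (auto simp: old_values_def)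
  also have "\<dots> = (\<Sum>r\<in>codes full m J k. k * m + of_bool (\<not> full))"
  proof (rule sum.cong[OF refl])
    fix r assume r: "r \<in> codes full m J k"
    then have "card (roots r) = k" by (simp add: codes_def)
    then show "card (old_values full m r) = k * m + of_bool (\<not> full)"
      using card_old_values[OF roots[OF r]] by simp
  qed
  also have "card (?g ` ?N) = card ?N" by (rule card_image[OF injg])
  finally show ?thesis by simp
qed

text \<open>Both sides obey the same recurrence, whose last variable is \<open>k m + 1\<close>, or
  \<open>k m\<close> for full codes. The induction adds the largest index and runs over all
  \<open>k\<close> at once.\<close>

lemma card_codes:
  assumes "0 < m" "finite J"
  shows "int (card (codes full m J k)) =
           complete_homogeneous (int (card J) - int k)
             (map (\<lambda>i. int i * int m + of_bool (\<not> full)) [0..<k + 1])"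
  using assms(2)
proof (induction J arbitrary: k rule: finite_linorder_max_induct)
  case empty
  have "codes full m {} k = (if k = 0 then {Map.empty} else {})"
    by (auto simp: codes_def code_def roots_def)
  then show ?case
    by (simp add: complete_homogeneous_0 complete_homogeneous_neg)
next
  case (insert x J)
  let ?ys = "\<lambda>k. map (\<lambda>i. int i * int m + of_bool (\<not> full)) [0..<k]"
  have card: "card (insert x J) = Suc (card J)"
    using insert(1,2) by (auto simp: card_insert_if)
  have "complete_homogeneous (int (Suc (card J)) - int k) (?ys (k + 1)) =
      complete_homogeneous (int (Suc (card J)) - int k) (?ys k) +
      (int k * int m + of_bool (\<not> full)) * complete_homogeneous (int (card J) - int k) (?ys (k + 1))"
    using complete_homogeneous_snoc[of "int (Suc (card J)) - int k" "?ys k"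
        "int k * int m + of_bool (\<not> full)"] by simp
  \<comment> \<open>Lowering the number of indices and \<open>k\<close> together leaves the degree
    unchanged. For \<open>k = 0\<close> no variable is left and the degree is positive, so the
    polynomial is 0.\<close>
  also have "complete_homogeneous (int (Suc (card J)) - int k) (?ys k) =
      int (if k = 0 then 0 else card (codes full m J (k - 1)))"
    using insert.IH[of "k - 1"] by (cases k) (simp_all add: complete_homogeneous_Nil)
  finally show ?case
    unfolding card card_codes_insert[OF assms(1) insert(1,2)] using insert.IH[of k] by simp
qed

section \<open>Colored elements\<close>

text \<open>After reducing the exponents modulo \<open>m\<close>, this is the distinctness of the
  \<open>m\<close> roots of unity.\<close>

lemma zeta_pow_eq_iff:
  assumes "0 < m"
  shows "zeta m ^ a = zeta m ^ b \<longleftrightarrow> a mod m = b mod m"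
proof -
  have cis: "zeta m ^ c = cis (2 * pi * real c / real m)" for c
  proof -
    have "zeta m = cis (2 * pi / real m)"
      by (simp add: zeta_def cis_conv_exp mult_ac)
    then show ?thesis by (simp add: DeMoivre mult_ac)
  qed
  have "zeta m ^ m = 1" using assms cis[of m] by simp
  then have "zeta m ^ (c mod m) = zeta m ^ c" for c
    by (metis mod_mult_div_eq mult_1_right power_add power_mult power_one)
  moreover have "zeta m ^ (a mod m) = zeta m ^ (b mod m) \<longleftrightarrow> a mod m = b mod m"
    using inj_on_eq_iff[OF bij_betw_imp_inj_on[OF bij_betw_roots_unity[OF assms]], of "a mod m" "b mod m"]
      assms by (simp add: cis)
  ultimately show ?thesis by simp
qed

lemma zeta_nonzero: "zeta m \<noteq> 0"
  by (simp add: zeta_def)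

lemma colored_elem_eq_iff:
  assumes "0 < m" "i < n" "j < n"
  shows "colored_elem m n i c = colored_elem m n j d \<longleftrightarrow> i = j \<and> c mod m = d mod m"
proof
  assume eq: "colored_elem m n i c = colored_elem m n j d"
  then have "colored_elem m n i c $ i = colored_elem m n j d $ i" by simp
  then have "zeta m ^ c = (if i = j then zeta m ^ d else 0)"
    using assms by (simp add: colored_elem_def unit_vec_def)
  then show "i = j \<and> c mod m = d mod m"
    using zeta_pow_eq_iff[OF assms(1)] zeta_nonzero[of m] by (cases "i = j") simp_all
next
  assume "i = j \<and> c mod m = d mod m"
  then show "colored_elem m n i c = colored_elem m n j d"
    using zeta_pow_eq_iff[OF assms(1), of c d] by (simp add: colored_elem_def)
qed

lemma colored_elem_mod:
  assumes "0 < m"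
  shows "colored_elem m n i (c mod m) = colored_elem m n i c"
  using zeta_pow_eq_iff[OF assms, of "c mod m" c] by (simp add: colored_elem_def)

lemma colored_elem_nonzero:
  assumes "i < n"
  shows "colored_elem m n i c \<noteq> 0\<^sub>v n"
proof
  assume "colored_elem m n i c = 0\<^sub>v n"
  then have "colored_elem m n i c $ i = 0\<^sub>v n $ i" by simp
  then show False using assms zeta_nonzero by (simp add: colored_elem_def)
qed

lemma smult_colored_elem: "zeta m ^ a \<cdot>\<^sub>v colored_elem m n i c = colored_elem m n i (a + c)"
  by (simp add: colored_elem_def power_add smult_smult_assoc)

text \<open>With colors ranging over all naturals, multiplying by a power of \<open>zeta m\<close>
  just adds to the color, without reduction.\<close>

lemma colored_ground_eq:
  assumes "0 < m"
  shows "colored_ground m n = insert (0\<^sub>v n) {colored_elem m n i c | i c. i < n}"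
proof -
  have "\<exists>d<m. colored_elem m n i c = colored_elem m n i d" for i c
    using colored_elem_mod[OF assms] assms by (metis mod_less_divisor)
  then show ?thesis unfolding colored_ground_def by blast
qed

lemma scale_set_scale_set: "scale_set a (scale_set b S) = scale_set (a * b) S"
  by (auto simp: scale_set_def image_image smult_smult_assoc)

section \<open>The partition of a code\<close>

text \<open>With \<open>r i = (j, b)\<close>, the element \<open>i\<^sup>c\<close> shares its block with \<open>j\<^sup>b\<^sup>+\<^sup>c\<close>.\<close>

definition label :: "nat \<Rightarrow> (nat \<rightharpoonup> nat \<times> nat) \<Rightarrow> nat \<Rightarrow> nat \<Rightarrow> (nat \<times> nat) option" where
  "label m r i c = map_option (\<lambda>(j, b). (j, (b + c) mod m)) (r i)"

definition labels :: "nat \<Rightarrow> (nat \<rightharpoonup> nat \<times> nat) \<Rightarrow> (nat \<times> nat) option set" where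
  "labels m r = insert None (Some ` (roots r \<times> {..<m}))"

definition block ::
    "nat \<Rightarrow> nat \<Rightarrow> (nat \<rightharpoonup> nat \<times> nat) \<Rightarrow> (nat \<times> nat) option \<Rightarrow> complex vec set" where
  "block m n r t =
     {x. x = 0\<^sub>v n \<and> t = None \<or> (\<exists>i c. i < n \<and> x = colored_elem m n i c \<and> label m r i c = t)}"

definition partition_of ::
    "nat \<Rightarrow> nat \<Rightarrow> (nat \<rightharpoonup> nat \<times> nat) \<Rightarrow> complex vec set set" where
  "partition_of m n r = block m n r ` labels m r"

text \<open>Partitions will be compared through their equivalence relations: that of
  \<open>partition_of m n r\<close> is equality of labels.\<close>

definition same_block :: "'a set set \<Rightarrow> 'a rel" where
  "same_block P = {(x, y). \<exists>p\<in>P. x \<in> p \<and> y \<in> p}"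

lemma label_None_iff: "label m r i c = None \<longleftrightarrow> r i = None"
  by (simp add: label_def)

lemma label_cong:
  assumes "c mod m = d mod m"
  shows "label m r i c = label m r i d"
proof -
  have "(b + c) mod m = (b + d) mod m" for b using assms by (metis mod_add_right_eq)
  then show ?thesis by (simp add: label_def)
qed

lemma zero_in_block: "0\<^sub>v n \<in> block m n r t \<longleftrightarrow> t = None"
proof -
  have "0\<^sub>v n \<noteq> colored_elem m n i c" if "i < n" for i c
    using colored_elem_nonzero[OF that] by metis
  then show ?thesis unfolding block_def by blast
qed

lemma colored_elem_in_block:
  assumes "0 < m" "i < n"
  shows "colored_elem m n i c \<in> block m n r t \<longleftrightarrow> label m r i c = t"
proof -
  have "label m r j d = label m r i c" if "j < n" "colored_elem m n i c = colored_elem m n j d" for j d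
    using that colored_elem_eq_iff[OF assms that(1)] label_cong[of d m c] by auto
  moreover have "colored_elem m n i c \<in> block m n r t \<longleftrightarrow>
      (\<exists>j d. j < n \<and> colored_elem m n i c = colored_elem m n j d \<and> label m r j d = t)"
    using colored_elem_nonzero[OF assms(2)] by (simp add: block_def)
  ultimately show ?thesis using assms(2) by metis
qed

lemma block_subset_ground:
  assumes "0 < m"
  shows "block m n r t \<subseteq> colored_ground m n"
  by (auto simp: colored_ground_eq[OF assms] block_def)

lemma block_unique:
  assumes "0 < m" "x \<in> block m n r t" "x \<in> block m n r u"
  shows "t = u"
proof -
  consider "x = 0\<^sub>v n" | i c where "i < n" "x = colored_elem m n i c"
    using block_subset_ground[OF assms(1)] assms(2) unfolding colored_ground_eq[OF assms(1)] by blast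
  then show ?thesis
    using assms by cases (simp_all add: zero_in_block colored_elem_in_block)
qed

lemma label_in_labels:
  assumes "0 < m" "code m r"
  shows "label m r i c \<in> labels m r"
proof (cases "r i")
  case None
  then show ?thesis by (simp add: label_def labels_def)
next
  case (Some p)
  then have "r (fst p) = Some (fst p, 0)" using codeD(3)[OF assms(2)] by (metis prod.collapse)
  then show ?thesis using Some assms(1) by (auto simp: label_def labels_def roots_def split: prod.split)
qed

text \<open>The root is the witness: its value is \<open>(j, 0)\<close>, so its color
  \<open>d\<close> has label \<open>(j, d)\<close>.\<close>

lemma block_nonempty:
  assumes "0 < m" "dom r \<subseteq> {..<n}" "t \<in> labels m r"
  shows "block m n r t \<noteq> {}"
proof (cases t)
  case None
  then show ?thesis using zero_in_block[of n m r t] by blast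
next
  case (Some p)
  then obtain j d where t: "t = Some (j, d)" by (cases p) auto
  then have j: "r j = Some (j, 0)" "d < m" using assms(3) by (auto simp: labels_def roots_def)
  then have "j < n" using assms(2) by auto
  then have "colored_elem m n j d \<in> block m n r t"
    using j by (simp add: colored_elem_in_block assms(1) label_def t)
  then show ?thesis by blast
qed

lemma inj_on_block:
  assumes "0 < m" "dom r \<subseteq> {..<n}"
  shows "inj_on (block m n r) (labels m r)"
proof (rule inj_onI)
  fix t u assume "t \<in> labels m r" and eq: "block m n r t = block m n r u"
  then obtain x where "x \<in> block m n r t" using block_nonempty[OF assms] by blast
  then show "t = u" using eq block_unique[OF assms(1)] by blast
qed

lemma partition_on_partition_of:
  assumes "0 < m" "code m r" "dom r \<subseteq> {..<n}"
  shows "partition_on (colored_ground m n) (partition_of m n r)"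
proof (rule partition_onI)
  show "\<Union> (partition_of m n r) = colored_ground m n"
  proof
    show "\<Union> (partition_of m n r) \<subseteq> colored_ground m n"
      using block_subset_ground[OF assms(1)] by (auto simp: partition_of_def)
    show "colored_ground m n \<subseteq> \<Union> (partition_of m n r)"
    proof
      fix x assume "x \<in> colored_ground m n"
      then consider "x = 0\<^sub>v n" | i c where "i < n" "x = colored_elem m n i c"
        unfolding colored_ground_eq[OF assms(1)] by blast
      then show "x \<in> \<Union> (partition_of m n r)"
      proof cases
        case 1
        then have "x \<in> block m n r None" by (simp add: zero_in_block)
        then show ?thesis unfolding partition_of_def labels_def by blast
      next
        case 2
        then have "x \<in> block m n r (label m r i c)" using assms(1) by (simp add: colored_elem_in_block)
        then show ?thesis using label_in_labels[OF assms(1,2)] unfolding partition_of_def by blast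
      qed
    qed
  qed
  show "{} \<notin> partition_of m n r"
    using block_nonempty[OF assms(1,3)] unfolding partition_of_def by (metis imageE)
  show "disjnt p q" if "p \<in> partition_of m n r" "q \<in> partition_of m n r" "p \<noteq> q" for p q
    using that block_unique[OF assms(1)] unfolding partition_of_def disjnt_def by blast
qed

lemma same_block_partition_of:
  assumes "0 < m" "code m r" "i < n" "j < n"
  shows "(colored_elem m n i c, colored_elem m n j d) \<in> same_block (partition_of m n r)
           \<longleftrightarrow> label m r i c = label m r j d"
  using label_in_labels[OF assms(1,2)] assms
  by (auto simp: same_block_def partition_of_def colored_elem_in_block)

lemma same_block_partition_of_zero:
  assumes "0 < m" "i < n"
  shows "(0\<^sub>v n, colored_elem m n i c) \<in> same_block (partition_of m n r) \<longleftrightarrow> r i = None"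
  using assms label_None_iff[of m r i c]
  by (auto simp: same_block_def partition_of_def labels_def colored_elem_in_block zero_in_block)

text \<open>Scaling by \<open>zeta m ^ d\<close> adds \<open>d\<close> to every color, hence
  \<open>d\<close> to the second component of every label.\<close>

lemma scale_block:
  assumes "0 < m" "d < m"
  shows "scale_set (zeta m ^ d) (block m n r (Some (j, 0))) = block m n r (Some (j, d))"
proof (intro equalityI subsetI)
  fix x assume "x \<in> scale_set (zeta m ^ d) (block m n r (Some (j, 0)))"
  then obtain i c where i: "i < n" and x: "x = colored_elem m n i (d + c)"
    and l: "label m r i c = Some (j, 0)"
    unfolding scale_set_def block_def by (auto simp: smult_colored_elem)
  obtain b where b: "r i = Some (j, b)" "(b + c) mod m = 0"
    using l by (auto simp: label_def)
  have "(b + (d + c)) mod m = ((b + c) mod m + d) mod m"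
    unfolding mod_add_left_eq by (simp add: ac_simps)
  then have "label m r i (d + c) = Some (j, d)" using b assms(2) by (simp add: label_def)
  then show "x \<in> block m n r (Some (j, d))" using i x unfolding block_def by blast
next
  fix x assume "x \<in> block m n r (Some (j, d))"
  then obtain i c where i: "i < n" and x: "x = colored_elem m n i c"
    and l: "label m r i c = Some (j, d)"
    unfolding block_def by auto
  obtain b where b: "r i = Some (j, b)" "(b + c) mod m = d"
    using l by (auto simp: label_def)
  \<comment> \<open>This is \<open>c - d\<close> modulo \<open>m\<close>, written so that the
    subtraction does not truncate.\<close>
  let ?c = "c + (m - d)"
  have "(b + ?c) mod m = ((b + c) mod m + (m - d)) mod m"
    unfolding mod_add_left_eq by (simp add: ac_simps)
  then have "label m r i ?c = Some (j, 0)" using b assms(2) by (simp add: label_def)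
  then have "colored_elem m n i ?c \<in> block m n r (Some (j, 0))" using i unfolding block_def by blast
  moreover have "x = zeta m ^ d \<cdot>\<^sub>v colored_elem m n i ?c"
    unfolding smult_colored_elem x using assms i by (subst colored_elem_eq_iff) simp_all
  ultimately show "x \<in> scale_set (zeta m ^ d) (block m n r (Some (j, 0)))"
    unfolding scale_set_def by blast
qed

lemma colored_set_partition_partition_of:
  assumes "0 < m" "code m r" "dom r \<subseteq> {..<n}"
  shows "colored_set_partition m n (partition_of m n r)"
    and "card (partition_of m n r) = card (roots r) * m + 1"
proof -
  let ?k = "card (roots r)"
  have "finite (roots r)"
    using roots_subset_dom assms(3) by (meson finite_lessThan finite_subset)
  then obtain g where g: "bij_betw g {..<?k} (roots r)"
    using ex_bij_betw_nat_finite by (metis lessThan_atLeast0)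
  \<comment> \<open>Position 0 is the zero block, and position \<open>l * m + 1 + d\<close> is color
    \<open>d\<close> over the \<open>l\<close>-th root, which is the numbering that the definition
    of a colored partition asks for.\<close>
  define t where "t x = (if x = 0 then None else Some (g ((x - 1) div m), (x - 1) mod m))" for x
  have div: "(x - 1) div m < ?k" if "x \<noteq> 0" "x \<le> ?k * m" for x
    using that by (intro less_mult_imp_div_less) simp
  have "bij_betw t {0..?k * m} (labels m r)"
  proof (rule bij_betw_imageI)
    show "inj_on t {0..?k * m}"
    proof (rule inj_onI)
      fix x y assume xy: "x \<in> {0..?k * m}" "y \<in> {0..?k * m}" "t x = t y"
      show "x = y"
      proof (cases "x = 0 \<or> y = 0")
        case True
        then show ?thesis using xy(3) by (auto simp: t_def split: if_splits)
      next
        case False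
        then have "g ((x - 1) div m) = g ((y - 1) div m)" and mod: "(x - 1) mod m = (y - 1) mod m"
          using xy(3) by (auto simp: t_def)
        then have "(x - 1) div m = (y - 1) div m"
          using inj_on_eq_iff[OF bij_betw_imp_inj_on[OF g]] div[of x] div[of y] False xy by auto
        with mod have "x - 1 = y - 1" by (metis div_mult_mod_eq)
        then show ?thesis using False by arith
      qed
    qed
    show "t ` {0..?k * m} = labels m r"
    proof (intro equalityI subsetI)
      fix u assume "u \<in> t ` {0..?k * m}"
      then obtain x where "u = t x" "x \<le> ?k * m" by auto
      then show "u \<in> labels m r"
        using div[of x] bij_betwE[OF g] assms(1) by (auto simp: t_def labels_def)
    next
      fix u assume u: "u \<in> labels m r"
      show "u \<in> t ` {0..?k * m}"
      proof (cases u)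
        case None
        then have "u = t 0" by (simp add: t_def)
        then show ?thesis by simp
      next
        case (Some p)
        then obtain j d where jd: "u = Some (j, d)" "j \<in> roots r" "d < m"
          using u by (auto simp: labels_def)
        then obtain l where l: "l < ?k" "j = g l"
          using bij_betw_imp_surj_on[OF g] by blast
        have "l * m + d < Suc l * m" using jd by simp
        also have "\<dots> \<le> ?k * m" using l by (intro mult_le_mono1) simp
        finally have "l * m + 1 + d \<in> {0..?k * m}" by simp
        moreover have "u = t (l * m + 1 + d)" using jd l by (simp add: t_def)
        ultimately show ?thesis by blast
      qed
    qed
  qed
  moreover have "bij_betw (block m n r) (labels m r) (partition_of m n r)"
    unfolding partition_of_def by (rule inj_on_imp_bij_betw[OF inj_on_block[OF assms(1,3)]])
  ultimately have bij: "bij_betw (block m n r \<circ> t) {0..?k * m} (partition_of m n r)"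
    by (rule bij_betw_trans)
  show "card (partition_of m n r) = ?k * m + 1"
    using bij_betw_same_card[OF bij] by simp
  have "\<forall>i<n. (\<exists>c<m. colored_elem m n i c \<in> (block m n r \<circ> t) 0) \<longrightarrow>
      (\<forall>d<m. colored_elem m n i d \<in> (block m n r \<circ> t) 0)"
    using assms(1) by (auto simp: t_def colored_elem_in_block label_None_iff)
  moreover have "\<exists>S. \<forall>j<m. (block m n r \<circ> t) (l * m + 1 + j) = scale_set (zeta m ^ j) S" for l
  proof (intro exI allI impI)
    fix j assume "j < m"
    then show "(block m n r \<circ> t) (l * m + 1 + j) =
        scale_set (zeta m ^ j) (block m n r (Some (g l, 0)))"
      using assms(1) by (simp add: t_def scale_block)
  qed
  moreover have "0\<^sub>v n \<in> (block m n r \<circ> t) 0" by (simp add: t_def zero_in_block)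
  ultimately show "colored_set_partition m n (partition_of m n r)"
    unfolding colored_set_partition_def
    using bij partition_on_partition_of[OF assms] by blast
qed

lemma inj_on_partition_of:
  assumes "0 < m"
  shows "inj_on (partition_of m n) {r. code m r \<and> dom r \<subseteq> {..<n}}"
proof -
  \<comment> \<open>By symmetry it is enough that every value of \<open>r\<close> is also a value of
    \<open>r'\<close>.\<close>
  have half: "r' i = Some (j, b)"
    if r: "code m r" "dom r \<subseteq> {..<n}" and r': "code m r'" "dom r' \<subseteq> {..<n}"
      and eq: "partition_of m n r = partition_of m n r'" and i: "r i = Some (j, b)" for r r' i j b
  proof -
    note same = same_block_partition_of[OF assms, where n = n]
    note zero = same_block_partition_of_zero[OF assms, where n = n]
    have j: "r j = Some (j, 0)" "b < m" using codeD[OF r(1) i] by auto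
    have n: "i < n" "j < n" using i j(1) r(2) by auto
    have "label m r i 0 = label m r j b" using i j by (simp add: label_def)
    then have l: "label m r' i 0 = label m r' j b"
      using same[OF r(1) n] same[OF r'(1) n] eq by simp
    have "r' i \<noteq> None"
      using zero[of i 0 r] zero[of i 0 r'] n eq i by simp
    then obtain l a where a: "r' i = Some (l, a)" by auto
    then obtain a' where a': "r' j = Some (l, a')" "a = (a' + b) mod m"
      using l a codeD(2)[OF r'(1) a] by (cases "r' j") (auto simp: label_def)
    have l': "r' l = Some (l, 0)" "a < m" "l \<le> j"
      using codeD[OF r'(1) a] codeD[OF r'(1) a'(1)] by auto
    then have ln: "l < n" using r'(2) by auto
    have "label m r' i 0 = label m r' l a" using a l' by (simp add: label_def)
    then have "label m r i 0 = label m r l a"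
      using same[OF r(1) n(1) ln] same[OF r'(1) n(1) ln] eq by simp
    then obtain e where "r l = Some (j, e)"
      using i by (cases "r l") (auto simp: label_def)
    \<comment> \<open>Each code points to the least index of the group: \<open>r'\<close> gives
      \<open>l \<le> j\<close>, and \<open>r l = Some (j, e)\<close> gives \<open>j \<le> l\<close>.
      Once the roots agree, \<open>a' = 0\<close>, so \<open>a = b mod m = b\<close>.\<close>
    then have "l = j" using codeD(1)[OF r(1)] l' by (meson le_antisym)
    then show ?thesis using a a' l' j by simp
  qed
  show ?thesis
  proof (rule inj_onI, rule ext)
    fix r r' i
    assume r: "r \<in> {r. code m r \<and> dom r \<subseteq> {..<n}}" and r': "r' \<in> {r. code m r \<and> dom r \<subseteq> {..<n}}"
      and eq: "partition_of m n r = partition_of m n r'"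
    have to: "r' i = Some (j, b)" if "r i = Some (j, b)" for j b
      using r r' by (intro half[OF _ _ _ _ eq that]) blast+
    have fro: "r i = Some (j, b)" if "r' i = Some (j, b)" for j b
      using r r' by (intro half[OF _ _ _ _ eq[symmetric] that]) blast+
    show "r i = r' i"
    proof (cases "r i")
      case None
      then show ?thesis using fro by (cases "r' i") auto
    next
      case (Some p)
      then show ?thesis using to[of "fst p" "snd p"] by simp
    qed
  qed
qed

section \<open>The code of a partition\<close>

text \<open>A nonzero block sits at some position \<open>l * m + 1 + j\<close>, and scaling by
  \<open>zeta m ^ a\<close> moves it to the position with \<open>(a + j) mod m\<close> in place of
  \<open>j\<close>, within the same group. As the numbering is injective, the block is fixed only if
  \<open>m\<close> divides \<open>a\<close>.\<close>

lemma scale_nonzero_block: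
  assumes "0 < m" "colored_set_partition m n P" "p \<in> P" "0\<^sub>v n \<notin> p"
  shows "scale_set (zeta m ^ a) p \<in> P"
    and "scale_set (zeta m ^ a) p = p \<Longrightarrow> a mod m = 0"
proof -
  obtain k B where B: "bij_betw B {0..k * m} P" "0\<^sub>v n \<in> B 0"
    and S: "\<forall>l<k. \<exists>S. \<forall>j<m. B (l * m + 1 + j) = scale_set (zeta m ^ j) S"
    using assms(2) unfolding colored_set_partition_def by blast
  obtain x where x: "x \<le> k * m" "p = B x"
    using assms(3) bij_betw_imp_surj_on[OF B(1)] by auto
  then have "x \<noteq> 0" using assms(4) B(2) by metis
  define l j where "l = (x - 1) div m" and "j = (x - 1) mod m"
  have lj: "l < k" "j < m" "x = l * m + 1 + j"
    using x(1) \<open>x \<noteq> 0\<close> assms(1) unfolding l_def j_def by (auto intro!: less_mult_imp_div_less)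
  obtain S where S: "\<And>j. j < m \<Longrightarrow> B (l * m + 1 + j) = scale_set (zeta m ^ j) S"
    using S lj(1) by blast
  let ?y = "l * m + 1 + (a + j) mod m"
  have j': "(a + j) mod m < m" using assms(1) by simp
  have "scale_set (zeta m ^ a) p = scale_set (zeta m ^ (a + j)) S"
    using x(2) lj S[OF lj(2)] by (simp add: scale_set_scale_set power_add)
  also have "zeta m ^ (a + j) = zeta m ^ ((a + j) mod m)"
    using zeta_pow_eq_iff[OF assms(1), of "a + j" "(a + j) mod m"] by simp
  finally have eq: "scale_set (zeta m ^ a) p = B ?y" using S[OF j'] by simp
  have "l * m + (a + j) mod m < Suc l * m" using j' by simp
  also have "\<dots> \<le> k * m" using lj by (intro mult_le_mono1) simp
  finally have y: "?y \<in> {0..k * m}" by simp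
  then show "scale_set (zeta m ^ a) p \<in> P" unfolding eq using bij_betwE[OF B(1)] by blast
  show "a mod m = 0" if "scale_set (zeta m ^ a) p = p"
  proof -
    have "B ?y = B x" using that eq x(2) by simp
    then have "?y = x"
      using inj_on_eq_iff[OF bij_betw_imp_inj_on[OF B(1)] y, of x] x(1) by simp
    then have "(a + j) mod m = j mod m" using lj by simp
    then show ?thesis using mod_eq_dvd_iff_nat[of j "a + j" m] by simp
  qed
qed

text \<open>Disjointness identifies \<open>p\<close> with \<open>B 0\<close>; reducing colors modulo
  \<open>m\<close> then extends condition (i) to arbitrary exponents.\<close>

lemma zero_block_full:
  assumes "0 < m" "colored_set_partition m n P" "p \<in> P" "0\<^sub>v n \<in> p" "i < n"
    and "colored_elem m n i c \<in> p"
  shows "colored_elem m n i d \<in> p"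
proof -
  obtain k B where B: "bij_betw B {0..k * m} P" "0\<^sub>v n \<in> B 0"
    and full: "\<forall>i<n. (\<exists>c<m. colored_elem m n i c \<in> B 0) \<longrightarrow> (\<forall>d<m. colored_elem m n i d \<in> B 0)"
    and part: "partition_on (colored_ground m n) P"
    using assms(2) unfolding colored_set_partition_def by blast
  have "B 0 \<in> P" using bij_betwE[OF B(1)] by simp
  then have "p = B 0"
    using partition_onD2[OF part] assms(3,4) B(2) by (auto simp: disjoint_def)
  moreover have "c mod m < m" "d mod m < m" using assms(1) by auto
  ultimately have "colored_elem m n i (d mod m) \<in> p"
    using full assms(5,6) colored_elem_mod[OF assms(1), of n i c] by metis
  then show ?thesis using colored_elem_mod[OF assms(1)] by simp
qed

lemma same_block_equiv:
  assumes "partition_on A P"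
  shows "equiv A (same_block P)"
  using equiv_partition_on[OF assms] unfolding same_block_def .

text \<open>A partition is the quotient of its ground set by its relation.\<close>

lemma partition_on_eq_iff_same_block:
  assumes "partition_on A P" "partition_on A Q"
  shows "P = Q \<longleftrightarrow> same_block P = same_block Q"
proof
  assume "same_block P = same_block Q"
  then have "A // same_block P = A // same_block Q" by simp
  then show "P = Q"
    using partition_on_eq_quotient[OF assms(1)] partition_on_eq_quotient[OF assms(2)]
    unfolding same_block_def by argo
qed simp

text \<open>The code is read off from the relation of \<open>P\<close>: the root of \<open>i\<close>
  is the least index meeting the block of \<open>i\<close> with color 0. Equal labels then turn out
  to mean equal blocks, so the code gives back the relation, and with it \<open>P\<close>.\<close>

lemma ex_code:
  assumes "0 < m" "colored_set_partition m n P"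
  obtains r where "code m r" "dom r \<subseteq> {..<n}" "partition_of m n r = P"
proof -
  let ?E = "colored_elem m n" and ?R = "same_block P"
  have part: "partition_on (colored_ground m n) P"
    using assms(2) unfolding colored_set_partition_def by blast
  have equiv: "equiv (colored_ground m n) ?R" by (rule same_block_equiv[OF part])
  have sym: "(y, x) \<in> ?R" if "(x, y) \<in> ?R" for x y
    using equiv that by (meson equivE symE)
  have trans: "(x, z) \<in> ?R" if "(x, y) \<in> ?R" "(y, z) \<in> ?R" for x y z
    using equiv that by (meson equivE transE)
  have refl: "(?E i c, ?E i c) \<in> ?R" if "i < n" for i c
  proof -
    have "?E i c \<in> colored_ground m n" using that colored_ground_eq[OF assms(1)] by blast
    then show ?thesis using equiv by (meson equivE refl_onD)
  qed
  have zero: "(0\<^sub>v n, ?E i d) \<in> ?R" if "(0\<^sub>v n, ?E i c) \<in> ?R" "i < n" for i c d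
    using that zero_block_full[OF assms] unfolding same_block_def by blast
  \<comment> \<open>The relation is invariant under rotation: the zero block contains all colors of
    its indices, and a nonzero block is carried to a block.\<close>
  have shift: "(?E i (a + c), ?E j (a + d)) \<in> ?R"
    if R: "(?E i c, ?E j d) \<in> ?R" and n: "i < n" "j < n" for i j a c d
  proof -
    obtain p where p: "p \<in> P" "?E i c \<in> p" "?E j d \<in> p"
      using R unfolding same_block_def by blast
    show ?thesis
    proof (cases "0\<^sub>v n \<in> p")
      case True
      then have "?E i (a + c) \<in> p" "?E j (a + d) \<in> p"
        using zero_block_full[OF assms p(1)] p n by blast+
      then show ?thesis using p(1) unfolding same_block_def by blast
    next
      case False
      have "?E i (a + c) \<in> scale_set (zeta m ^ a) p" "?E j (a + d) \<in> scale_set (zeta m ^ a) p"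
        using p unfolding scale_set_def smult_colored_elem[symmetric] by blast+
      then show ?thesis
        using scale_nonzero_block(1)[OF assms p(1) False] unfolding same_block_def by blast
    qed
  qed
  \<comment> \<open>Two distinct colors of one index cannot share a nonzero block, since the
    rotation taking one to the other would fix that block.\<close>
  have faithful: "c mod m = d mod m"
    if R: "(?E i c, ?E i d) \<in> ?R" and "(0\<^sub>v n, ?E i 0) \<notin> ?R" and i: "i < n" for i c d
  proof -
    obtain p where p: "p \<in> P" "?E i c \<in> p" "?E i d \<in> p"
      using R unfolding same_block_def by blast
    have "0\<^sub>v n \<notin> p"
      using that(2) zero[OF _ i, of c 0] p unfolding same_block_def by blast
    note scale = scale_nonzero_block[OF assms p(1) this]
    \<comment> \<open>This represents \<open>d - c\<close> modulo \<open>m\<close> by a natural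
      number.\<close>
    define a where "a = d + (m - 1) * c"
    have ac: "a + c = d + m * c" using assms(1) unfolding a_def by (cases m) simp_all
    then have "?E i (a + c) = ?E i d" using assms(1) i by (simp add: colored_elem_eq_iff)
    then have "?E i d \<in> scale_set (zeta m ^ a) p"
      using p(2) unfolding scale_set_def by (metis image_eqI smult_colored_elem)
    \<comment> \<open>Both blocks contain color \<open>d\<close> of \<open>i\<close>, so
      disjointness makes them equal.\<close>
    then have "scale_set (zeta m ^ a) p = p"
      using scale(1)[of a] p partition_onD2[OF part] unfolding disjoint_def by blast
    then have "a mod m = 0" by (rule scale(2))
    then have "(a + c) mod m = c mod m" by (metis add_0 mod_add_left_eq)
    then show ?thesis using ac by simp
  qed

  define meets where "meets i j \<longleftrightarrow> j < n \<and> (\<exists>b. (?E i 0, ?E j b) \<in> ?R)" for i j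
  define root where "root i = (LEAST j. meets i j)" for i
  define col where "col i = (SOME b. b < m \<and> (?E i 0, ?E (root i) b) \<in> ?R)" for i
  define r where
    "r i = (if i < n \<and> (0\<^sub>v n, ?E i 0) \<notin> ?R then Some (root i, col i) else None)" for i
  have meets_self: "meets i i" if "i < n" for i
    using refl[OF that] that unfolding meets_def by blast
  have root: "root i \<le> i" "meets i (root i)" if "i < n" for i
    using meets_self[OF that] unfolding root_def by (auto intro: Least_le LeastI)
  have root_le: "root i \<le> j" if "meets i j" for i j
    using that unfolding root_def by (rule Least_le)
  have col: "col i < m \<and> (?E i 0, ?E (root i) (col i)) \<in> ?R" if i: "i < n" for i
  proof -
    obtain b where "(?E i 0, ?E (root i) b) \<in> ?R" using root(2)[OF i] unfolding meets_def by blast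
    then have "(?E i 0, ?E (root i) (b mod m)) \<in> ?R" by (simp add: colored_elem_mod assms(1))
    then have "\<exists>b. b < m \<and> (?E i 0, ?E (root i) b) \<in> ?R"
      using assms(1) by (metis mod_less_divisor)
    then show ?thesis unfolding col_def by (rule someI_ex)
  qed
  have meets: "meets i j" if R: "(?E i c, ?E j d) \<in> ?R" and n: "i < n" "j < n" for i j c d
  proof -
    \<comment> \<open>Rotating by \<open>(m - 1) * c\<close> brings color \<open>c\<close> back to
      color 0, as \<open>meets\<close> requires.\<close>
    have "(m - 1) * c + c = m * c" using assms(1) by (cases m) simp_all
    then have "?E i ((m - 1) * c + c) = ?E i 0" using assms(1) n by (simp add: colored_elem_eq_iff)
    then show ?thesis using shift[OF R n, of "(m - 1) * c"] n unfolding meets_def by metis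
  qed
  have root_n: "root i < n" if "i < n" for i using root(2)[OF that] by (simp add: meets_def)
  have to_root: "(?E i c, ?E (root i) (col i + c)) \<in> ?R" if i: "i < n" for i c
    using shift[OF conjunct2[OF col[OF i]] i root_n[OF i], of c] by (simp add: ac_simps)
  \<comment> \<open>Each of the two indices meets the root of the other, so minimality gives both
    inequalities.\<close>
  have root_eq: "root i = root j" if R: "(?E i c, ?E j d) \<in> ?R" and n: "i < n" "j < n" for i j c d
  proof (rule antisym)
    show "root i \<le> root j"
      by (rule root_le, rule meets[OF trans[OF R to_root[OF n(2)]] n(1) root_n[OF n(2)]])
    show "root j \<le> root i"
      by (rule root_le, rule meets[OF trans[OF sym[OF R] to_root[OF n(1)]] n(2) root_n[OF n(1)]])
  qed
  have nonzero: "(0\<^sub>v n, ?E j 0) \<notin> ?R"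
    if "(?E i c, ?E j d) \<in> ?R" "(0\<^sub>v n, ?E i 0) \<notin> ?R" "i < n" "j < n" for i j c d
    using that zero trans sym by blast
  have code: "code m r"
    unfolding code_def
  proof (intro allI impI)
    fix i j b assume "r i = Some (j, b)"
    then have i: "i < n" "(0\<^sub>v n, ?E i 0) \<notin> ?R" and j: "j = root i" and b: "b = col i"
      by (auto simp: r_def split: if_splits)
    have jn: "j < n" using root_n[OF i(1)] j by simp
    have R: "(?E i 0, ?E j b) \<in> ?R" using col[OF i(1)] j b by simp
    have nz: "(0\<^sub>v n, ?E j 0) \<notin> ?R" by (rule nonzero[OF R i(2,1) jn])
    \<comment> \<open>A root is its own root, and then \<open>faithful\<close> forces its color to
      be 0.\<close>
    have "root j = j" using root_eq[OF R i(1) jn] j by simp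
    moreover from this have "(?E j 0, ?E j (col j)) \<in> ?R" using col[OF jn] by simp
    then have "0 mod m = col j mod m" using faithful nz jn by blast
    then have "col j = 0" using col[OF jn] by simp
    ultimately have "r j = Some (j, 0)" using jn nz by (simp add: r_def)
    then show "j \<le> i \<and> b < m \<and> r j = Some (j, 0)"
      using root(1)[OF i(1)] col[OF i(1)] j b by simp
  qed
  have dom: "dom r \<subseteq> {..<n}" by (auto simp: r_def split: if_splits)
  have zero_iff: "r i = None \<longleftrightarrow> (0\<^sub>v n, ?E i c) \<in> ?R" if "i < n" for i c
    using that zero[OF _ that] by (auto simp: r_def)
  have label_iff: "label m r i c = label m r j d \<longleftrightarrow> (?E i c, ?E j d) \<in> ?R"
    if n: "i < n" "j < n" for i j c d
  proof (cases "r i = None \<or> r j = None")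
    case True
    have "(?E i c, ?E j d) \<in> ?R \<longleftrightarrow> r i = None \<and> r j = None"
      using True zero_iff[OF n(1), of c] zero_iff[OF n(2), of d] sym trans by blast
    moreover have "label m r i c = label m r j d \<longleftrightarrow> r i = None \<and> r j = None"
      using True by (auto simp: label_def)
    ultimately show ?thesis by simp
  next
    case False
    then have r: "r i = Some (root i, col i)" "r j = Some (root j, col j)"
      and nz: "(0\<^sub>v n, ?E i 0) \<notin> ?R"
      by (auto simp: r_def split: if_splits)
    show ?thesis
    proof
      assume "label m r i c = label m r j d"
      then have "root i = root j" "(col i + c) mod m = (col j + d) mod m"
        using r by (auto simp: label_def)
      then have "?E (root i) (col i + c) = ?E (root j) (col j + d)"
        using assms(1) root_n[OF n(1)] by (simp add: colored_elem_eq_iff)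
      then show "(?E i c, ?E j d) \<in> ?R"
        using to_root[OF n(1), of c] to_root[OF n(2), of d] sym trans by metis
    next
      \<comment> \<open>Carrying both elements to their common root gives two colors of one index in
        one nonzero block, and \<open>faithful\<close> applies.\<close>
      assume R: "(?E i c, ?E j d) \<in> ?R"
      have eq: "root j = root i" using root_eq[OF R n] by simp
      have "(?E (root i) (col i + c), ?E (root i) (col j + d)) \<in> ?R"
        using trans[OF sym[OF to_root[OF n(1)]] trans[OF R to_root[OF n(2)]]] eq by simp
      moreover have "(0\<^sub>v n, ?E (root i) 0) \<notin> ?R"
        by (rule nonzero[OF to_root[OF n(1)] nz n(1) root_n[OF n(1)]])
      ultimately have "(col i + c) mod m = (col j + d) mod m"
        using faithful root_n[OF n(1)] by blast
      then show "label m r i c = label m r j d" using r eq by (simp add: label_def)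
    qed
  qed
  let ?Q = "same_block (partition_of m n r)"
  have partQ: "partition_on (colored_ground m n) (partition_of m n r)"
    by (rule partition_on_partition_of[OF assms(1) code dom])
  note equivQ = same_block_equiv[OF partQ]
  \<comment> \<open>Both relations live on the ground set, so comparing them there suffices; the
    cases are whether \<open>x\<close> or \<open>y\<close> is the zero vector.\<close>
  have "(x, y) \<in> ?Q \<longleftrightarrow> (x, y) \<in> ?R" if "x \<in> colored_ground m n" "y \<in> colored_ground m n" for x y
  proof -
    have commute: "(x, y) \<in> S \<longleftrightarrow> (y, x) \<in> S" if "equiv (colored_ground m n) S" for S
      using that by (meson equivE symE)
    have elem: "(0\<^sub>v n, ?E i c) \<in> ?Q \<longleftrightarrow> (0\<^sub>v n, ?E i c) \<in> ?R" if "i < n" for i c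
      using same_block_partition_of_zero[OF assms(1) that] zero_iff[OF that] by simp
    have "(0\<^sub>v n, 0\<^sub>v n) \<in> S" if "equiv (colored_ground m n) S" for S
      using that unfolding colored_ground_def by (meson equivE insertI1 refl_onD)
    then have zz: "(0\<^sub>v n, 0\<^sub>v n) \<in> ?Q" "(0\<^sub>v n, 0\<^sub>v n) \<in> ?R" using equiv equivQ by blast+
    have elems: "x = 0\<^sub>v n \<or> (\<exists>i c. i < n \<and> x = ?E i c)" "y = 0\<^sub>v n \<or> (\<exists>i c. i < n \<and> y = ?E i c)"
      using that unfolding colored_ground_eq[OF assms(1)] by auto
    show ?thesis
    proof (cases "x = 0\<^sub>v n")
      case True
      then show ?thesis using elems(2) elem zz by metis
    next
      case x: False
      show ?thesis
      proof (cases "y = 0\<^sub>v n")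
        case True
        then show ?thesis using elems(1) x elem commute[OF equiv] commute[OF equivQ] by metis
      next
        case False
        then obtain i c j d where "i < n" "x = ?E i c" "j < n" "y = ?E j d"
          using elems x by blast
        then show ?thesis
          using same_block_partition_of[OF assms(1) code] label_iff by metis
      qed
    qed
  qed
  moreover have "?Q \<subseteq> colored_ground m n \<times> colored_ground m n"
    "?R \<subseteq> colored_ground m n \<times> colored_ground m n"
    using partition_onD1[OF part] partition_onD1[OF partQ] unfolding same_block_def by blast+
  ultimately have "?Q = ?R" by blast
  then have "partition_of m n r = P" using partition_on_eq_iff_same_block[OF partQ part] by blast
  with code dom show ?thesis by (rule that)
qed

section \<open>Transfer of the counts to colored set partitions\<close>

lemma bij_betw_partition_of:
  assumes "0 < m"
  shows "bij_betw (partition_of m n) (codes False m {..<n} k)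
           {P. colored_set_partition m n P \<and> card P = k * m + 1}"
proof (rule bij_betw_imageI)
  show "inj_on (partition_of m n) (codes False m {..<n} k)"
    by (rule inj_on_subset[OF inj_on_partition_of[OF assms]]) (auto simp: codes_def)
  show "partition_of m n ` codes False m {..<n} k =
      {P. colored_set_partition m n P \<and> card P = k * m + 1}"
  proof (intro equalityI subsetI)
    fix P assume "P \<in> partition_of m n ` codes False m {..<n} k"
    then show "P \<in> {P. colored_set_partition m n P \<and> card P = k * m + 1}"
      using colored_set_partition_partition_of[OF assms] by (auto simp: codes_def)
  next
    fix P assume P: "P \<in> {P. colored_set_partition m n P \<and> card P = k * m + 1}"
    then obtain r where r: "code m r" "dom r \<subseteq> {..<n}" "partition_of m n r = P"
      using ex_code[OF assms] by blast
    have "card (roots r) * m + 1 = k * m + 1"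
      using colored_set_partition_partition_of(2)[OF assms r(1,2)] r(3) P by simp
    then have "card (roots r) = k" using assms by simp
    then show "P \<in> partition_of m n ` codes False m {..<n} k"
      using r by (auto simp: codes_def)
  qed
qed

lemma zero_block_partition_of:
  assumes "0 < m" "code m r" "dom r \<subseteq> {..<n}"
  shows "zero_block n (partition_of m n r) = block m n r None"
  unfolding zero_block_def
proof (rule the_equality)
  show "block m n r None \<in> partition_of m n r \<and> 0\<^sub>v n \<in> block m n r None"
    by (auto simp: partition_of_def labels_def zero_in_block)
  show "S = block m n r None" if "S \<in> partition_of m n r \<and> 0\<^sub>v n \<in> S" for S
    using that by (auto simp: partition_of_def zero_in_block)
qed

text \<open>The zero block consists of 0 and all colors of the indices without a value. The excluded
  partitions are therefore those whose code is full on \<open>{..<n} - {i}\<close> for some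
  \<open>i\<close>.\<close>

lemma zero_block_singleton_iff:
  assumes "0 < m" "dom r \<subseteq> {..<n}" "i < n"
  shows "block m n r None = insert (0\<^sub>v n) (colored_elem m n i ` {..<m}) \<longleftrightarrow> dom r = {..<n} - {i}"
    (is "?L = ?R")
proof
  assume eq: ?L
  have "r j = None \<longleftrightarrow> j = i" if j: "j < n" for j
  proof -
    have "r j = None \<longleftrightarrow> colored_elem m n j 0 \<in> block m n r None"
      using colored_elem_in_block[OF assms(1) j] label_None_iff by metis
    also have "\<dots> \<longleftrightarrow> j = i"
      unfolding eq using colored_elem_nonzero[OF j] colored_elem_eq_iff[OF assms(1) j assms(3)]
        assms(1) by auto
    finally show ?thesis .
  qed
  then have "j \<in> dom r \<longleftrightarrow> j \<in> {..<n} - {i}" for j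
    using assms(2) by (cases "j < n") (auto simp: domIff)
  then show ?R by blast
next
  assume dom: ?R
  have none: "r j = None \<longleftrightarrow> j = i" if "j < n" for j
    using dom that by blast
  have "block m n r None = insert (0\<^sub>v n) (range (colored_elem m n i))"
    using none assms(3) by (auto simp: block_def label_None_iff)
  also have "range (colored_elem m n i) = colored_elem m n i ` {..<m}"
  proof -
    have "colored_elem m n i c \<in> colored_elem m n i ` {..<m}" for c
      using imageI[of "c mod m" "{..<m}" "colored_elem m n i"] assms(1) by (simp add: colored_elem_mod)
    then show ?thesis by blast
  qed
  finally show ?L .
qed

lemma colored_stirling_eq:
  assumes "0 < m"
  shows "int (colored_stirling m n k) =
           complete_homogeneous (int n - int k) (map (\<lambda>i. int i * int m + 1) [0..<k + 1])"
proof -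
  have "colored_stirling m n k = card (codes False m {..<n} k)"
    unfolding colored_stirling_def using bij_betw_same_card[OF bij_betw_partition_of[OF assms]] by simp
  then show ?thesis using card_codes[OF assms, of "{..<n}" False k] by simp
qed

lemma colored_stirling_bar_eq:
  assumes "0 < m"
  shows "int (colored_stirling_bar m n k) = int (colored_stirling m n k)
           - int n * complete_homogeneous (int n - int k - 1) (map (\<lambda>i. int i * int m) [1..<k + 1])"
proof -
  let ?C = "codes False m {..<n} k" and ?D = "\<lambda>i. codes True m ({..<n} - {i}) k"
  let ?f = "partition_of m n"
  let ?bad = "\<lambda>P. \<exists>i<n. zero_block n P = insert (0\<^sub>v n) (colored_elem m n i ` {..<m})"
  note bij = bij_betw_partition_of[OF assms, of n k]
  have bad: "?bad (?f r) \<longleftrightarrow> (\<exists>i<n. r \<in> ?D i)" if r: "r \<in> ?C" for r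
  proof -
    have r': "code m r" "dom r \<subseteq> {..<n}" "card (roots r) = k" using r by (auto simp: codes_def)
    then have "?bad (?f r) \<longleftrightarrow> (\<exists>i<n. dom r = {..<n} - {i})"
      using zero_block_partition_of[OF assms r'(1,2)] zero_block_singleton_iff[OF assms r'(2)] by metis
    also have "\<dots> \<longleftrightarrow> (\<exists>i<n. r \<in> ?D i)" using r' by (auto simp: codes_def)
    finally show ?thesis .
  qed
  have "{P. colored_set_partition m n P \<and> card P = k * m + 1 \<and> \<not> ?bad P} = {P \<in> ?f ` ?C. \<not> ?bad P}"
    unfolding bij_betw_imp_surj_on[OF bij] by auto
  also have "\<dots> = ?f ` (?C - (\<Union>i\<in>{..<n}. ?D i))" using bad by blast
  finally have "colored_stirling_bar m n k = card (?f ` (?C - (\<Union>i\<in>{..<n}. ?D i)))"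
    unfolding colored_stirling_bar_def by simp
  also have "\<dots> = card (?C - (\<Union>i\<in>{..<n}. ?D i))"
    by (rule card_image, rule inj_on_subset[OF bij_betw_imp_inj_on[OF bij]]) auto
  finally have bar: "colored_stirling_bar m n k = card (?C - (\<Union>i\<in>{..<n}. ?D i))" .
  have finD: "finite (?D i)" for i by (rule finite_codes) simp
  have sub: "(\<Union>i\<in>{..<n}. ?D i) \<subseteq> ?C" by (auto simp: codes_def)
  have cardC: "card ?C = colored_stirling m n k"
    unfolding colored_stirling_def using bij_betw_same_card[OF bij] by simp
  have "int (colored_stirling_bar m n k) = int (card ?C) - int (card (\<Union>i\<in>{..<n}. ?D i))"
    unfolding bar using finD card_mono[OF finite_codes sub]
    by (subst card_Diff_subset[OF _ sub]) auto
  also have "card (\<Union>i\<in>{..<n}. ?D i) = (\<Sum>i<n. card (?D i))"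
  proof (rule card_UN_disjoint)
    \<comment> \<open>The domain of a full code determines the missing index.\<close>
    show "\<forall>i\<in>{..<n}. \<forall>j\<in>{..<n}. i \<noteq> j \<longrightarrow> ?D i \<inter> ?D j = {}"
      by (auto simp: codes_def)
  qed (use finD in auto)
  also have "int \<dots> = (\<Sum>i<n. int (card (?D i)))" by simp
  also have "\<dots> =
      (\<Sum>i<n. complete_homogeneous (int n - int k - 1) (map (\<lambda>i. int i * int m) [1..<k + 1]))"
  proof (rule sum.cong[OF refl])
    fix i assume i: "i \<in> {..<n}"
    have "map (\<lambda>i. int i * int m) [0..<k + 1] = 0 # map (\<lambda>i. int i * int m) [1..<k + 1]"
      by (simp add: upt_conv_Cons)
    \<comment> \<open>Only \<open>n - 1\<close> indices remain, which accounts for the degree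
      \<open>n - k - 1\<close>.\<close>
    moreover have "int (card ({..<n} - {i})) - int k = int n - int k - 1"
      using i by (simp add: of_nat_diff)
    moreover have "int (card (?D i)) = complete_homogeneous (int (card ({..<n} - {i})) - int k)
        (map (\<lambda>i. int i * int m) [0..<k + 1])"
      using card_codes[OF assms, of "{..<n} - {i}" True k] by simp
    ultimately show "int (card (?D i)) =
        complete_homogeneous (int n - int k - 1) (map (\<lambda>i. int i * int m) [1..<k + 1])"
      by (simp only: complete_homogeneous_zero_var)
  qed
  finally show ?thesis using cardC by simp
qed

theorem theorem2p5:
  fixes m n k :: nat
  assumes "m \<ge> 1"
  shows "int (colored_stirling m n k) =
           complete_homogeneous (int n - int k) (map (\<lambda>i. int i * int m + 1) [0..<k + 1])
       \<and> int (colored_stirling_bar m n k) =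
           complete_homogeneous (int n - int k) (map (\<lambda>i. int i * int m + 1) [0..<k + 1])
           - int n * complete_homogeneous (int n - int k - 1) (map (\<lambda>i. int i * int m) [1..<k + 1])"
  using assms colored_stirling_eq[of m n k] colored_stirling_bar_eq[of m n k] by simp

end
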